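(* Let $p$ be a prime with $p\equiv13\pmod{24}$. Then $$\sum_{k=0}^{(p-13)/24}\binom{24k}{12k}\frac1{4^{12k}}\equiv\frac1{12}\big(1-2\cdot3^{(p-1)/4}\big)\pmod p$$ and $$\sum_{k=0}^{(p-1)/12}\binom{12k}{6k}\frac{(-1)^k}{4^{6k}}\equiv0\pmod p.$$
   Context: Congruences of rationals with denominators prime to $p$ are taken in the ring of such rationals. *)

theory Defs
  imports Complex_Main "HOL-Number_Theory.Cong"
begin

definition rat_p_integral :: "nat \<Rightarrow> rat \<Rightarrow> bool" where
  "rat_p_integral p x \<longleftrightarrow> coprime (snd (quotient_of x)) (int p)"

text \<open>Congruence in the ring of rationals with denominator prime to \<open>p\<close>: both sides
  lie in this ring, and their difference lies in the ideal generated by \<open>p\<close>.\<close>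

definition rat_cong :: "rat \<Rightarrow> rat \<Rightarrow> nat \<Rightarrow> bool" where
  "rat_cong x y p \<longleftrightarrow> rat_p_integral p x \<and> rat_p_integral p y \<and>
     (\<exists>z. rat_p_integral p z \<and> x - y = of_nat p * z)"

end

theory Submission
  imports Defs
begin

text \<open>
  Put \<open>m = (p - 1) / 2\<close>. Modulo \<open>p\<close> the number \<open>binom(2n, n) / 4^n\<close> equals
  \<open>(-1)^n binom(m, n)\<close>, so both sums become sums of \<open>binom(m, n)\<close> over a residue class of \<open>n\<close>.
  Since \<open>m = 12a + 6\<close>, the reflection \<open>n \<mapsto> m - n\<close> kills the alternating sum over the multiples
  of 6, and hence the sum over the multiples of 12 is half the sum over the multiples of 6. The
  latter is \<open>(2^m + 2 - 2 * 3^(m/2)) / 6\<close>. Finally \<open>2^m \<equiv> -1\<close>, which is the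
  congruence for \<open>binom(2n, n)\<close> at \<open>n = m / 2\<close>, where both binomial coefficients coincide.
\<close>

subsection \<open>Congruences in the ring of \<open>p\<close>-integral rationals\<close>

text \<open>The reduced denominator divides every denominator of the same rational, so any
  representation with a denominator prime to \<open>p\<close> suffices.\<close>

lemma rat_p_integral_divide:
  assumes "b \<noteq> 0" "coprime b (int p)"
  shows "rat_p_integral p (of_int a / of_int b)"
proof -
  obtain c d where cd: "quotient_of (of_int a / of_int b) = (c, d)" by (rule prod.exhaust)
  have d: "d > 0" "coprime c d"
    using quotient_of_denom_pos[OF cd] quotient_of_coprime[OF cd] by auto
  have "(of_int a / of_int b :: rat) = of_int c / of_int d"
    using cd by (rule quotient_of_div)
  then have "(of_int (a * d) :: rat) = of_int (c * b)"
    using d assms by (simp add: field_simps)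
  then have "a * d = c * b" by (simp only: of_int_eq_iff)
  then have "d dvd c * b" by (metis dvd_triv_right)
  then have "d dvd b" using d by (simp add: coprime_commute coprime_dvd_mult_right_iff)
  then have "coprime d (int p)" using assms(2) coprime_divisors[of d b "int p" "int p"] by simp
  then show ?thesis by (simp add: rat_p_integral_def cd)
qed

lemma rat_p_integralE:
  assumes "rat_p_integral p x"
  obtains a b where "x = of_int a / of_int b" "b \<noteq> 0" "coprime b (int p)"
proof -
  obtain c d where cd: "quotient_of x = (c, d)" by (rule prod.exhaust)
  show ?thesis
  proof (rule that)
    show "x = of_int c / of_int d" using cd by (rule quotient_of_div)
    show "d \<noteq> 0" using quotient_of_denom_pos[OF cd] by simp
    show "coprime d (int p)" using assms by (simp add: rat_p_integral_def cd)
  qed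
qed

lemma rat_p_integral_of_int: "rat_p_integral p (of_int a)"
  using rat_p_integral_divide[of 1 p a] by simp

lemma rat_p_integral_add:
  assumes "rat_p_integral p x" "rat_p_integral p y"
  shows "rat_p_integral p (x + y)"
proof -
  obtain a b c d where *: "x = of_int a / of_int b" "b \<noteq> 0" "coprime b (int p)"
    "y = of_int c / of_int d" "d \<noteq> 0" "coprime d (int p)"
    using assms by (elim rat_p_integralE)
  then have "x + y = of_int (a * d + c * b) / of_int (b * d)"
    by (simp add: field_simps)
  then show ?thesis using rat_p_integral_divide[of "b * d" p "a * d + c * b"] * by simp
qed

lemma rat_cong_refl_of_int: "rat_cong (of_int a) (of_int a) p"
  using rat_p_integral_of_int[of p a] rat_p_integral_of_int[of p 0]
  by (auto simp: rat_cong_def intro!: exI[of _ 0])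

lemma rat_cong_add:
  assumes "rat_cong x y p" "rat_cong x' y' p"
  shows "rat_cong (x + x') (y + y') p"
proof -
  obtain z z' where "rat_p_integral p z" "x - y = of_nat p * z"
    "rat_p_integral p z'" "x' - y' = of_nat p * z'"
    using assms by (auto simp: rat_cong_def)
  then have "rat_p_integral p (z + z')" "x + x' - (y + y') = of_nat p * (z + z')"
    by (simp_all add: rat_p_integral_add algebra_simps)
  then show ?thesis using assms by (auto simp: rat_cong_def rat_p_integral_add)
qed

lemma rat_cong_trans [trans]:
  assumes "rat_cong x y p" "rat_cong y w p"
  shows "rat_cong x w p"
proof -
  obtain z z' where "rat_p_integral p z" "x - y = of_nat p * z"
    "rat_p_integral p z'" "y - w = of_nat p * z'"
    using assms by (auto simp: rat_cong_def)
  then have "rat_p_integral p (z + z')" "x - w = of_nat p * (z + z')"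
    by (simp_all add: rat_p_integral_add algebra_simps)
  then show ?thesis using assms by (auto simp: rat_cong_def)
qed

lemma rat_cong_sum:
  assumes "\<And>k. k \<in> A \<Longrightarrow> rat_cong (f k) (g k) p"
  shows "rat_cong (sum f A) (sum g A) p"
  using assms
proof (induction A rule: infinite_finite_induct)
  case (insert x F)
  then show ?case by (simp add: rat_cong_add)
qed (use rat_cong_refl_of_int[of 0 p] in simp_all)

lemma rat_cong_divide_of_int:
  assumes "b \<noteq> 0" "coprime b (int p)" "[a = b * c] (mod int p)"
  shows "rat_cong (of_int a / of_int b) (of_int c) p"
proof -
  obtain d where "a - b * c = int p * d"
    using assms(3) by (auto simp: cong_iff_dvd_diff)
  then have "(of_int (a - b * c) :: rat) = of_int (int p * d)" by (rule arg_cong)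
  then have "of_int a / of_int b - of_int c = of_nat p * (of_int d / of_int b :: rat)"
    using assms(1) by (simp add: field_simps)
  then show ?thesis
    unfolding rat_cong_def
    using assms rat_p_integral_divide[of b p] rat_p_integral_of_int[of p c] by blast
qed

text \<open>Mirror image of \<open>rat_cong_divide_of_int\<close>, used in place of symmetry of
  \<open>rat_cong\<close> to end a chain in a fraction.\<close>

lemma rat_cong_of_int_divide:
  assumes "b \<noteq> 0" "coprime b (int p)" "[b * c = a] (mod int p)"
  shows "rat_cong (of_int c) (of_int a / of_int b) p"
proof -
  obtain d where "b * c - a = int p * d"
    using assms(3) by (auto simp: cong_iff_dvd_diff)
  then have "(of_int (b * c - a) :: rat) = of_int (int p * d)" by (rule arg_cong)
  then have "of_int c - of_int a / of_int b = of_nat p * (of_int d / of_int b :: rat)"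
    using assms(1) by (simp add: field_simps)
  then show ?thesis
    unfolding rat_cong_def
    using assms rat_p_integral_divide[of b p] rat_p_integral_of_int[of p c] by blast
qed

subsection \<open>Central binomial coefficients modulo \<open>p\<close>\<close>

lemma Suc_times_central_binomial_Suc:
  "Suc n * ((2 * Suc n) choose Suc n) = 2 * (2 * n + 1) * ((2 * n) choose n)"
proof -
  \<comment> \<open>The extra factor \<open>Suc n\<close> allows absorption to be applied twice; it
    is cancelled at the end.\<close>
  have "Suc n * (Suc n * ((2 * Suc n) choose Suc n)) = Suc n * (Suc (2 * n + 1) * ((2 * n + 1) choose n))"
    using Suc_times_binomial_eq[of "2 * n + 1" n] by simp
  also have "\<dots> = Suc (2 * n + 1) * (Suc n * (Suc (2 * n) choose Suc n))"
    using binomial_symmetric[of n "2 * n + 1"] by (simp add: algebra_simps)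
  also have "\<dots> = Suc (2 * n + 1) * (Suc (2 * n) * ((2 * n) choose n))"
    using Suc_times_binomial_eq[of "2 * n" n] by simp
  also have "\<dots> = Suc n * (2 * (2 * n + 1) * ((2 * n) choose n))"
    by (simp add: algebra_simps)
  finally show ?thesis by (subst (asm) mult_cancel1) simp
qed

text \<open>Multiplied by \<open>n + 1\<close>, the next term is \<open>2 * (2 * n + 1)\<close>
  times the current one on the left and \<open>-4 * (m - n)\<close> times it on the right. These
  factors agree modulo \<open>p\<close>, and \<open>n + 1\<close> is invertible because
  \<open>0 < n + 1 \<le> m < p\<close>.\<close>

lemma central_binomial_cong:
  assumes "prime p" "p = 2 * m + 1" "n \<le> m"
  shows "[int ((2 * n) choose n) = (-4) ^ n * int (m choose n)] (mod int p)"
  using assms(3)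
proof (induction n)
  case (Suc n)
  have c1: "int (Suc n) * int ((2 * Suc n) choose Suc n) = 2 * (2 * int n + 1) * int ((2 * n) choose n)"
    using Suc_times_central_binomial_Suc[of n, THEN arg_cong[of _ _ int]]
    by (simp only: of_nat_mult of_nat_add of_nat_numeral of_nat_1)
  have "Suc n * (m choose Suc n) = (m - n) * (m choose n)"
    using binomial_absorb_comp[of m n] binomial_absorption[of n "m"] by simp
  from this[THEN arg_cong[of _ _ int]]
  have c2: "int (Suc n) * int (m choose Suc n) = (int m - int n) * int (m choose n)"
    using Suc.prems by (simp only: of_nat_mult of_nat_diff Suc_leD)
  have "int (Suc n) * ((-4) ^ Suc n * int (m choose Suc n)) =
      - 4 * (-4) ^ n * (int (Suc n) * int (m choose Suc n))"
    by (simp add: algebra_simps)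
  \<comment> \<open>From \<open>p = 2 * m + 1\<close>:
    \<open>-4 * (m - n) = 2 * (2 * n + 1) - 2 * p\<close>.\<close>
  also have "\<dots> = 2 * (2 * int n + 1) * ((-4) ^ n * int (m choose n))
      + int p * (- 2 * (-4) ^ n * int (m choose n))"
    unfolding c2 assms(2) by (simp add: algebra_simps)
  also have "[\<dots> = 2 * (2 * int n + 1) * ((-4) ^ n * int (m choose n))] (mod int p)"
    by (simp add: cong_iff_dvd_diff)
  also have "[2 * (2 * int n + 1) * ((-4) ^ n * int (m choose n)) =
      int (Suc n) * int ((2 * Suc n) choose Suc n)] (mod int p)"
    unfolding c1 using Suc.IH Suc.prems by (simp add: cong_scalar_left cong_sym)
  finally have *: "[int (Suc n) * int ((2 * Suc n) choose Suc n) =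
      int (Suc n) * ((-4) ^ Suc n * int (m choose Suc n))] (mod int p)"
    by (rule cong_sym)
  have "\<not> p dvd Suc n" using Suc.prems assms(2) by (auto dest: dvd_imp_le)
  then have "coprime (int (Suc n)) (int p)"
    using prime_imp_coprime[OF assms(1), of "Suc n"]
    by (simp only: coprime_int_iff coprime_commute not_False_eq_True simp_thms)
  from iffD1[OF cong_mult_lcancel[OF this] *] show ?case .
qed simp

text \<open>Even \<open>n\<close> gives \<open>(-4) ^ n = 4 ^ n\<close>, so the only sign left is
  the one supplied through \<open>t\<close>.\<close>

lemma rat_cong_central_binomial:
  assumes "prime p" "p = 2 * m + 1" "n \<le> m" "even n"
  shows "rat_cong (of_nat ((2 * n) choose n) * (of_int t / 4 ^ n))
           (of_int t * of_int (int (m choose n))) p"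
proof -
  have "coprime (2 :: int) (int p)" using assms(2) by simp
  then have "coprime (4 ^ n :: int) (int p)"
    using coprime_mult_left_iff[of 2 2 "int p"] by simp
  moreover have "[int ((2 * n) choose n) * t = 4 ^ n * (t * int (m choose n))] (mod int p)"
    using cong_scalar_right[OF central_binomial_cong[OF assms(1-3)], of t] assms(4)
    by (simp add: ac_simps)
  ultimately show ?thesis
    using rat_cong_divide_of_int[of "4 ^ n" p "int ((2 * n) choose n) * t" "t * int (m choose n)"]
    by simp
qed

lemma two_power_cong_minus_one:
  assumes "prime p" "p = 4 * q + 1" "odd q"
  shows "[2 ^ (2 * q) = -1] (mod int p)"
proof -
  have "\<not> p dvd ((2 * q) choose q)"
  proof
    assume "p dvd ((2 * q) choose q)"
    \<comment> \<open>The binomial coefficient divides \<open>fact (2 * q)\<close>, whose factors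
      are all smaller than \<open>p\<close>.\<close>
    then have "p dvd fact (2 * q)"
      using binomial_fact_lemma[of q "2 * q"] dvd_mult[of p "(2 * q) choose q" "fact q * fact q"]
      by simp
    then show False using assms by (simp add: prime_dvd_fact_iff)
  qed
  then have cop: "coprime (int ((2 * q) choose q)) (int p)"
    using prime_imp_coprime[OF assms(1), of "(2 * q) choose q"]
    by (simp only: coprime_int_iff coprime_commute not_False_eq_True simp_thms)
  have "[int ((2 * q) choose q) * 1 = int ((2 * q) choose q) * (-4) ^ q] (mod int p)"
    using central_binomial_cong[OF assms(1), of "2 * q" q] assms(2) by (simp add: mult.commute)
  from iffD1[OF cong_mult_lcancel[OF cop] this] have "[- 1 = - ((-4) ^ q)] (mod int p)" by (simp add: cong_minus_minus_iff)
  moreover have "- ((-4) ^ q) = (2 ^ (2 * q) :: int)"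
    using assms(3) by (simp add: power_mult)
  ultimately show ?thesis by (simp add: cong_sym)
qed

subsection \<open>Binomial sums over residue classes modulo 6\<close>

text \<open>All residues are kept, since Pascal's rule mixes neighbouring classes; the full range
  with a conditional lets that rule act termwise.\<close>

definition binom_class6 :: "nat \<Rightarrow> nat \<Rightarrow> int" where
  "binom_class6 n r = (\<Sum>j\<le>n. if j mod 6 = r then int (n choose j) else 0)"

lemma binom_class6_0: "binom_class6 0 r = (if r = 0 then 1 else 0)"
  by (simp add: binom_class6_def)

lemma binom_class6_Suc:
  assumes "\<And>j. Suc j mod 6 = r \<longleftrightarrow> j mod 6 = r'"
  shows "binom_class6 (Suc n) r = binom_class6 n r + binom_class6 n r'"
proof -
  \<comment> \<open>The term \<open>j = 0\<close> is split off so that Pascal's rule applies to all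
    others.\<close>
  have "binom_class6 (Suc n) r = (if 0 = r then 1 else 0) +
      (\<Sum>j\<le>n. if Suc j mod 6 = r then int (n choose Suc j) + int (n choose j) else 0)"
    unfolding binom_class6_def by (subst sum.atMost_Suc_shift) (simp add: add.commute cong: if_cong)
  also have "\<dots> = (if 0 = r then 1 else 0) +
      (\<Sum>j\<le>n. if Suc j mod 6 = r then int (n choose Suc j) else 0) + binom_class6 n r'"
    unfolding binom_class6_def add.assoc sum.distrib[symmetric]
    by (intro arg_cong2[of _ _ _ _ "(+)"] sum.cong refl) (simp add: assms)
  also have "(if 0 = r then 1 else 0) +
      (\<Sum>j\<le>n. if Suc j mod 6 = r then int (n choose Suc j) else 0) =
      (\<Sum>j\<le>Suc n. if j mod 6 = r then int (n choose j) else 0)"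
    by (subst sum.atMost_Suc_shift) simp
  \<comment> \<open>The additional term \<open>j = Suc n\<close> is zero, as
    \<open>n choose Suc n = 0\<close>.\<close>
  also have "\<dots> = binom_class6 n r"
    by (simp add: binom_class6_def)
  finally show ?thesis .
qed

lemma binom_class6_pascal:
  "binom_class6 (Suc n) 0 = binom_class6 n 0 + binom_class6 n 5"
  "binom_class6 (Suc n) 1 = binom_class6 n 1 + binom_class6 n 0"
  "binom_class6 (Suc n) 2 = binom_class6 n 2 + binom_class6 n 1"
  "binom_class6 (Suc n) 3 = binom_class6 n 3 + binom_class6 n 2"
  "binom_class6 (Suc n) 4 = binom_class6 n 4 + binom_class6 n 3"
  "binom_class6 (Suc n) 5 = binom_class6 n 5 + binom_class6 n 4"
  by (rule binom_class6_Suc; presburger)+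

text \<open>Six Pascal steps weight the classes by 1, 6, 15, 20, 15, 6, 1; the two outer weights
  fall on the same class and add up to 2.\<close>

lemma binom_class6_Suc6:
  "binom_class6 (Suc (Suc (Suc (Suc (Suc (Suc n)))))) 0 = 2 * binom_class6 n 0 + 6 * (binom_class6 n 1 + binom_class6 n 5) +
     15 * (binom_class6 n 2 + binom_class6 n 4) + 20 * binom_class6 n 3"
  "binom_class6 (Suc (Suc (Suc (Suc (Suc (Suc n)))))) 1 = 2 * binom_class6 n 1 + 6 * (binom_class6 n 2 + binom_class6 n 0) +
     15 * (binom_class6 n 3 + binom_class6 n 5) + 20 * binom_class6 n 4"
  "binom_class6 (Suc (Suc (Suc (Suc (Suc (Suc n)))))) 2 = 2 * binom_class6 n 2 + 6 * (binom_class6 n 3 + binom_class6 n 1) +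
     15 * (binom_class6 n 4 + binom_class6 n 0) + 20 * binom_class6 n 5"
  "binom_class6 (Suc (Suc (Suc (Suc (Suc (Suc n)))))) 3 = 2 * binom_class6 n 3 + 6 * (binom_class6 n 4 + binom_class6 n 2) +
     15 * (binom_class6 n 5 + binom_class6 n 1) + 20 * binom_class6 n 0"
  "binom_class6 (Suc (Suc (Suc (Suc (Suc (Suc n)))))) 4 = 2 * binom_class6 n 4 + 6 * (binom_class6 n 5 + binom_class6 n 3) +
     15 * (binom_class6 n 0 + binom_class6 n 2) + 20 * binom_class6 n 1"
  "binom_class6 (Suc (Suc (Suc (Suc (Suc (Suc n)))))) 5 = 2 * binom_class6 n 5 + 6 * (binom_class6 n 0 + binom_class6 n 4) +
     15 * (binom_class6 n 1 + binom_class6 n 3) + 20 * binom_class6 n 2"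
  by (simp_all only: binom_class6_pascal distrib_left)

text \<open>
  The roots of unity filter: with \<open>w = exp(i pi / 3)\<close> the summands come from
  \<open>(1 + w^j)^(6b)\<close> for \<open>j = 0\<close>, \<open>j = 2, 4\<close> and \<open>j = 1, 5\<close>; the term for \<open>j = 3\<close> vanishes as
  \<open>b > 0\<close>.
\<close>

lemma binom_class6_closed_form:
  defines "c \<equiv> \<lambda>b r. 6 * binom_class6 (6 * Suc b) r"
  shows "c b 0 = 64 ^ Suc b + 2 + 2 * (-27) ^ Suc b \<and>
    c b 1 = 64 ^ Suc b - 1 + (-27) ^ Suc b \<and>
    c b 2 = 64 ^ Suc b - 1 - (-27) ^ Suc b \<and>
    c b 3 = 64 ^ Suc b + 2 - 2 * (-27) ^ Suc b \<and>
    c b 4 = 64 ^ Suc b - 1 - (-27) ^ Suc b \<and>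
    c b 5 = 64 ^ Suc b - 1 + (-27) ^ Suc b"
proof (induction b)
  case 0
  have "6 * Suc 0 = Suc (Suc (Suc (Suc (Suc (Suc 0)))))" by simp
  then show ?case
    unfolding c_def by (simp only: binom_class6_pascal binom_class6_0) simp
next
  case (Suc b)
  have "6 * Suc (Suc b) = Suc (Suc (Suc (Suc (Suc (Suc (6 * Suc b))))))" by simp
  then have step: "c (Suc b) r = 6 * binom_class6 (Suc (Suc (Suc (Suc (Suc (Suc (6 * Suc b))))))) r" for r
    by (simp only: c_def)
  \<comment> \<open>The sixfold step is a linear map; the three parts of the closed form are
    eigenvectors with eigenvalues 64, 1 and -27, so linear arithmetic suffices.\<close>
  show ?case
    using Suc.IH unfolding step binom_class6_Suc6 power_Suc[of _ "Suc b"]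
    unfolding c_def by (elim conjE, intro conjI; simp)
qed

lemma binom_class6_eq_sum_multiples:
  "binom_class6 (6 * b) 0 = (\<Sum>k=0..b. int ((6 * b) choose (6 * k)))"
proof -
  have "binom_class6 (6 * b) 0 = (\<Sum>j\<in>{j\<in>{..6 * b}. j mod 6 = 0}. int ((6 * b) choose j))"
    unfolding binom_class6_def by (subst sum.inter_filter) simp_all
  also have "{j\<in>{..6 * b}. j mod 6 = 0} = (*) 6 ` {0..b}"
    by (auto simp: image_iff elim!: dvdE)
  also have "(\<Sum>j\<in>\<dots>. int ((6 * b) choose j)) = (\<Sum>k=0..b. int ((6 * b) choose (6 * k)))"
    by (subst sum.reindex) (auto simp: inj_on_def)
  finally show ?thesis .
qed

text \<open>For odd \<open>b\<close>, the indices \<open>k\<close> and \<open>b - k\<close> have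
  opposite parity but equal binomial coefficients, so the sum is its own negative.\<close>

lemma alternating_sum_multiples_eq_0:
  assumes "odd b"
  shows "(\<Sum>k=0..b. (-1) ^ k * int ((6 * b) choose (6 * k))) = 0" (is "?S = 0")
proof -
  have "?S = (\<Sum>k=0..b. (-1) ^ (b - k) * int ((6 * b) choose (6 * (b - k))))"
    using sum.atLeastAtMost_rev[of "\<lambda>k. (-1) ^ k * int ((6 * b) choose (6 * k))" 0 b] by simp
  also have "\<dots> = (\<Sum>k=0..b. - ((-1) ^ k * int ((6 * b) choose (6 * k))))"
  proof (rule sum.cong[OF refl])
    fix k assume "k \<in> {0..b}"
    then have "k \<le> b" by simp
    then have "(6 * b) choose (6 * (b - k)) = (6 * b) choose (6 * k)"
      using binomial_symmetric[of "6 * k" "6 * b"] by (simp add: diff_mult_distrib2)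
    moreover have "(-1) ^ (b - k) = - ((-1 :: int) ^ k)"
      using assms \<open>k \<le> b\<close> by (cases "even k") simp_all
    ultimately show "(-1) ^ (b - k) * int ((6 * b) choose (6 * (b - k))) =
        - ((-1) ^ k * int ((6 * b) choose (6 * k)))" by simp
  qed
  also have "\<dots> = - ?S" by (rule sum_negf)
  finally show ?thesis by simp
qed

text \<open>Odd terms cancel and even terms double; the odd upper limit makes each induction step
  add one complete pair.\<close>

lemma sum_plus_alternating_sum:
  fixes f :: "nat \<Rightarrow> int"
  shows "(\<Sum>k=0..2 * a + 1. f k) + (\<Sum>k=0..2 * a + 1. (-1) ^ k * f k) = 2 * (\<Sum>k=0..a. f (2 * k))"
  by (induction a) (simp_all add: algebra_simps)

lemma sum_binomial_multiples_12:
  "12 * (\<Sum>k=0..a. int ((12 * a + 6) choose (12 * k))) = 2 ^ (12 * a + 6) + 2 - 2 * 3 ^ (6 * a + 3)"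
proof -
  have m: "12 * a + 6 = 6 * (2 * a + 1)" by simp
  have "12 * (\<Sum>k=0..a. int ((12 * a + 6) choose (12 * k))) =
      6 * (2 * (\<Sum>k=0..a. int ((6 * (2 * a + 1)) choose (6 * (2 * k)))))"
    by (simp add: algebra_simps)
  also have "\<dots> = 6 * binom_class6 (6 * Suc (2 * a)) 0"
    unfolding sum_plus_alternating_sum[of "\<lambda>k. int ((6 * (2 * a + 1)) choose (6 * k))", symmetric]
    using alternating_sum_multiples_eq_0[of "2 * a + 1"] binom_class6_eq_sum_multiples[of "2 * a + 1"]
    by simp
  also have "\<dots> = 64 ^ (2 * a + 1) + 2 + 2 * (-27) ^ (2 * a + 1)"
    using binom_class6_closed_form[of "2 * a"] by simp
  also have "(64 :: int) ^ (2 * a + 1) = 2 ^ (12 * a + 6)"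
    unfolding m power_mult by simp
  \<comment> \<open>The exponent is odd, which produces the minus sign before the power of
    3.\<close>
  also have "(-27 :: int) ^ (2 * a + 1) = - (3 ^ (3 * (2 * a + 1)))"
    unfolding power_mult by simp
  also have "3 * (2 * a + 1) = 6 * a + 3" by simp
  finally show ?thesis by simp
qed

theorem theorem4p6:
  fixes p :: nat
  assumes "prime p" and "[p = 13] (mod 24)"
  shows "rat_cong
           (\<Sum>k = 0..(p - 13) div 24. of_nat ((24 * k) choose (12 * k)) * (1 / 4 ^ (12 * k)))
           (1 / 12 * (1 - 2 * 3 ^ ((p - 1) div 4))) p
       \<and> rat_cong
           (\<Sum>k = 0..(p - 1) div 12. of_nat ((12 * k) choose (6 * k)) * ((-1) ^ k / 4 ^ (6 * k)))
           0 p"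
proof -
  define a where "a = p div 24"
  have p: "p = 24 * a + 13"
    using assms(2) mult_div_mod_eq[of 24 p] by (simp add: a_def cong_def)
  define m where "m = 12 * a + 6"
  have m6: "m = 6 * (2 * a + 1)" by (simp add: m_def)
  have pm: "p = 2 * m + 1" by (simp add: p m_def)
  have "rat_cong (\<Sum>k=0..a. of_nat ((24 * k) choose (12 * k)) * (1 / 4 ^ (12 * k)))
      (\<Sum>k=0..a. 1 * of_int (int (m choose (12 * k)))) p"
  proof (rule rat_cong_sum)
    fix k assume "k \<in> {0..a}"
    then show "rat_cong (of_nat ((24 * k) choose (12 * k)) * (1 / 4 ^ (12 * k)))
        (1 * of_int (int (m choose (12 * k)))) p"
      using rat_cong_central_binomial[OF assms(1) pm, of "12 * k" 1] by (simp add: m_def)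
  qed
  also have "(\<Sum>k=0..a. 1 * of_int (int (m choose (12 * k)))) =
      (of_int (\<Sum>k=0..a. int (m choose (12 * k))) :: rat)" by simp
  also have "rat_cong (of_int (\<Sum>k=0..a. int (m choose (12 * k))))
      (of_int (1 - 2 * 3 ^ (6 * a + 3)) / of_int 12) p"
  proof (rule rat_cong_of_int_divide)
    \<comment> \<open>The prime \<open>p\<close> is at least 13, so 12 is invertible modulo
      \<open>p\<close>.\<close>
    have "coprime 2 p" "coprime 3 p"
      using p assms(1) by (simp, intro primes_coprime, simp_all)
    then have "coprime (2 * 2 * 3) p" by (simp only: coprime_mult_left_iff)
    then show "coprime 12 (int p)"
      using coprime_int_iff[of 12 p] by simp
    \<comment> \<open>Here \<open>q = 6 * a + 3\<close> is odd, \<open>p = 4 * q + 1\<close> and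
      \<open>m = 2 * q\<close>.\<close>
    have "[2 ^ m = - 1] (mod int p)"
      using two_power_cong_minus_one[OF assms(1), of "6 * a + 3"] by (simp add: p m_def)
    then have "[2 ^ m + (2 - 2 * 3 ^ (6 * a + 3)) = - 1 + (2 - 2 * 3 ^ (6 * a + 3))] (mod int p)"
      by (rule cong_add) simp
    moreover have "2 ^ m + (2 - 2 * 3 ^ (6 * a + 3)) = 12 * (\<Sum>k=0..a. int (m choose (12 * k)))"
      using sum_binomial_multiples_12[of a] by (simp add: m_def)
    ultimately show "[12 * (\<Sum>k=0..a. int (m choose (12 * k))) = 1 - 2 * 3 ^ (6 * a + 3)] (mod int p)"
      by simp
  qed simp
  finally have first: "rat_cong (\<Sum>k=0..a. of_nat ((24 * k) choose (12 * k)) * (1 / 4 ^ (12 * k)))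
      (of_int (1 - 2 * 3 ^ (6 * a + 3)) / of_int 12) p" .
  have "rat_cong (\<Sum>k=0..2 * a + 1. of_nat ((12 * k) choose (6 * k)) * ((-1) ^ k / 4 ^ (6 * k)))
      (\<Sum>k=0..2 * a + 1. (-1) ^ k * of_int (int (m choose (6 * k)))) p"
  proof (rule rat_cong_sum)
    fix k assume "k \<in> {0..2 * a + 1}"
    then show "rat_cong (of_nat ((12 * k) choose (6 * k)) * ((-1) ^ k / 4 ^ (6 * k)))
        ((-1) ^ k * of_int (int (m choose (6 * k)))) p"
      \<comment> \<open>The index \<open>6 * k\<close> is even, so the alternating sign enters only
        as \<open>t\<close>.\<close>
      using rat_cong_central_binomial[OF assms(1) pm, of "6 * k" "(-1) ^ k"]
      by (simp add: m_def)
  qed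
  also have "(\<Sum>k=0..2 * a + 1. (-1) ^ k * of_int (int (m choose (6 * k)))) =
      (of_int (\<Sum>k=0..2 * a + 1. (-1) ^ k * int ((6 * (2 * a + 1)) choose (6 * k))) :: rat)"
    unfolding m6 by simp
  \<comment> \<open>The integer sum vanishes exactly, because \<open>m / 6 = 2 * a + 1\<close> is
    odd.\<close>
  also have "\<dots> = 0" by (subst alternating_sum_multiples_eq_0) simp_all
  finally have second: "rat_cong
      (\<Sum>k=0..2 * a + 1. of_nat ((12 * k) choose (6 * k)) * ((-1) ^ k / 4 ^ (6 * k))) 0 p" .
  have "(p - 13) div 24 = a" "(p - 1) div 4 = 6 * a + 3" "(p - 1) div 12 = 2 * a + 1"
    by (simp_all add: p)
  then show ?thesis using first second by simp
qed

end
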